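(* Let $T$ be a finite tree with $E(T)\neq\varnothing$. Then: (a) The map $F_T$ has a unique fixed point $w_T^\star\in[1,\infty)^{E(T)}$. (b) $\mathrm{DN}_{\mathrm{LLY}}(T)=\max_{e\in E(T)}w_T^\star(e)$. (c) The fixed point $w_T^\star$ is coordinatewise minimal among normalized admissible weights (i.e. it is a normalized admissible weight and $w_T^\star\le z$ coordinatewise for every normalized admissible weight $z$), and it is the unique normalized optimal weight. Equivalently, all optimal weights of $T$ differ only by a global positive scalar. (d) Every pendant edge $e$ satisfies $w_T^\star(e)=1$, while every non-pendant edge has zero Lin--Lu--Yau curvature under $w_T^\star$.
   Context: Graphs are simple and undirected. Let $d(\cdot,\cdot)$ be the combinatorial graph distance. For a positive edge weight $w:E\to(0,\infty)$ put $d_x^w:=\sum_{y\sim x}w_{xy}$. For $\alpha\in[0,1]$ let $\mu_x^{\alpha,w}$ be the probability measure with $\mu_x^{\alpha,w}(x)=\alpha$, $\mu_x^{\alpha,w}(z)=(1-\alpha)w_{xz}/d_x^w$ for $z\sim x$, and $0$ otherwise. Let $W_1$ be the $1$-Wasserstein distance with respect to $d$. For $x\sim y$ let $\kappa_\alpha^w(x,y):=1-W_1(\mu_x^{\alpha,w},\mu_y^{\alpha,w})$ and define the weighted Lin--Lu--Yau curvature $\kappa_{\mathrm{LLY}}^w(x,y):=\lim_{\alpha\to1^-}\kappa_\alpha^w(x,y)/(1-\alpha)$. For connected locally finite $G$ with $E\neq\varnothing$: $\mathrm{Dist}(w):=\sup_{e\in E}w_e/\inf_{e\in E}w_e$, with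 value $+\infty$ if the supremum is infinite or the infimum is $0$; a positive weight $w$ is admissible if $\kappa_{\mathrm{LLY}}^w(e)\ge0$ for every $e\in E$; and $\mathrm{DN}_{\mathrm{LLY}}(G):=\inf\{\mathrm{Dist}(w): w \text{ admissible}\}$, with value $+\infty$ if no admissible weight has finite distortion. An admissible weight $w$ is optimal if $\mathrm{Dist}(w)=\mathrm{DN}_{\mathrm{LLY}}(G)$. A finite-distortion weight is normalized if $\inf_{e}w_e=1$. An edge of a tree is pendant if it is incident with a leaf (vertex of degree $1$), and non-pendant otherwise. For a tree $T$, $x\in[1,\infty)^{E(T)}$ and an edge $uv$, put $A_{u\mid v}(x):=\sum_{f\ni u,\ f\ne uv}x_f$ (sum over edges $f$ of $T$ incident with $u$ other than $uv$). The map $F_T:[1,\infty)^{E(T)}\to[1,\infty)^{E(T)}$ is defined by $$(F_T(x))_{uv}:=\max\Bigl\{1,\sqrt{A_{u\mid v}(x)\,A_{v\mid u}(x)}\Bigr\},\qquad uv\in E(T).$$ *)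

theory Defs
  imports "HOL-Probability.Probability"
begin

section \<open>Graphs and trees\<close>

text \<open>An undirected graph is a vertex set \<open>V\<close> together with a set \<open>E\<close> of two-element subsets of
  \<open>V\<close>; thus the edge \<open>xy\<close> is \<open>{x, y}\<close>.\<close>

definition nbrs :: "'a set set \<Rightarrow> 'a \<Rightarrow> 'a set" where
  "nbrs E x = {y. {x, y} \<in> E}"

definition adj_rel :: "'a set set \<Rightarrow> ('a \<times> 'a) set" where
  "adj_rel E = {(x, y). {x, y} \<in> E}"

locale simple_graph =
  fixes V :: "'a set" and E :: "'a set set"
  assumes edge_subset: "e \<in> E \<Longrightarrow> e \<subseteq> V"
    and edge_card: "e \<in> E \<Longrightarrow> card e = 2"

locale connected_locally_finite_graph = simple_graph V E
  for V :: "'a set" and E :: "'a set set" +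
  assumes connected: "x \<in> V \<Longrightarrow> y \<in> V \<Longrightarrow> (x, y) \<in> (adj_rel E)\<^sup>*"
    and locally_finite: "x \<in> V \<Longrightarrow> finite (nbrs E x)"

definition is_cycle :: "'a set set \<Rightarrow> 'a list \<Rightarrow> bool" where
  "is_cycle E xs \<longleftrightarrow> length xs \<ge> 3 \<and> distinct xs \<and>
     (\<forall>i<length xs. {xs ! i, xs ! (Suc i mod length xs)} \<in> E)"

locale finite_tree = connected_locally_finite_graph V E
  for V :: "'a set" and E :: "'a set set" +
  assumes finite_V: "finite V"
    and acyclic: "\<not> is_cycle E xs"

definition pendant :: "'a set set \<Rightarrow> 'a set \<Rightarrow> bool" where
  "pendant E e \<longleftrightarrow> (\<exists>v\<in>e. card (nbrs E v) = 1)"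

text \<open>The length of a shortest walk; only meaningful for vertices joined by some walk.\<close>

definition graph_dist :: "'a set set \<Rightarrow> 'a \<Rightarrow> 'a \<Rightarrow> nat" where
  "graph_dist E x y = (LEAST n. (x, y) \<in> adj_rel E ^^ n)"


section \<open>Weighted Lin--Lu--Yau curvature\<close>

definition wdeg :: "'a set set \<Rightarrow> ('a set \<Rightarrow> real) \<Rightarrow> 'a \<Rightarrow> real" where
  "wdeg E w x = (\<Sum>y\<in>nbrs E x. w {x, y})"

definition lazy_walk :: "'a set set \<Rightarrow> ('a set \<Rightarrow> real) \<Rightarrow> real \<Rightarrow> 'a \<Rightarrow> 'a pmf" where
  "lazy_walk E w \<alpha> x = embed_pmf (\<lambda>z. if z = x then \<alpha>
     else if z \<in> nbrs E x then (1 - \<alpha>) * w {x, z} / wdeg E w x else 0)"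

text \<open>\<^const>\<open>embed_pmf\<close> is only meaningful for genuine mass functions. The next lemma shows that
  this is the case for every non-isolated vertex of a locally finite simple graph.\<close>

lemma pmf_lazy_walk:
  fixes E :: "'a set set"
  assumes "\<And>e. e \<in> E \<Longrightarrow> card e = 2" and fin: "finite (nbrs E x)" and ne: "nbrs E x \<noteq> {}"
    and pos: "\<And>e. e \<in> E \<Longrightarrow> w e > 0" and \<alpha>: "0 \<le> \<alpha>" "\<alpha> \<le> 1"
  shows "pmf (lazy_walk E w \<alpha> x) z = (if z = x then \<alpha>
     else if z \<in> nbrs E x then (1 - \<alpha>) * w {x, z} / wdeg E w x else 0)"
proof -
  define f where "f = (\<lambda>z. if z = x then \<alpha>
     else if z \<in> nbrs E x then (1 - \<alpha>) * w {x, z} / wdeg E w x else 0)"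
  have x: "x \<notin> nbrs E x"
    using assms(1)[of "{x}"] by (auto simp: nbrs_def)
  have d: "wdeg E w x > 0"
    unfolding wdeg_def using fin ne pos by (intro sum_pos) (auto simp: nbrs_def)
  have nonneg: "f z \<ge> 0" for z
  proof (cases "z \<in> nbrs E x")
    case True
    then have "w {x, z} > 0"
      using pos by (auto simp: nbrs_def)
    then show ?thesis
      using \<alpha> d by (auto simp: f_def)
  qed (use \<alpha> in \<open>auto simp: f_def\<close>)
  have "(\<Sum>z\<in>insert x (nbrs E x). f z) = \<alpha> + (\<Sum>z\<in>nbrs E x. f z)"
    using fin x by (simp add: f_def)
  also have "(\<Sum>z\<in>nbrs E x. f z) = (\<Sum>z\<in>nbrs E x. (1 - \<alpha>) * w {x, z} / wdeg E w x)"
    using x by (intro sum.cong) (auto simp: f_def)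
  also have "\<dots> = (1 - \<alpha>) * wdeg E w x / wdeg E w x"
    by (simp add: wdeg_def sum_distrib_left sum_divide_distrib)
  finally have sum1: "(\<Sum>z\<in>insert x (nbrs E x). f z) = 1"
    using d by simp
  have "(\<integral>\<^sup>+ z. ennreal (f z) \<partial>count_space UNIV) = (\<Sum>z\<in>insert x (nbrs E x). ennreal (f z))"
    using fin by (intro nn_integral_count_space') (auto simp: f_def)
  also have "\<dots> = 1"
    using nonneg sum1 by (subst sum_ennreal) auto
  finally have "pmf (embed_pmf f) z = f z"
    using nonneg by (intro pmf_embed_pmf) auto
  then show ?thesis
    by (simp add: lazy_walk_def f_def)
qed

definition couplings :: "'a pmf \<Rightarrow> 'a pmf \<Rightarrow> ('a \<times> 'a) pmf set" where
  "couplings \<mu> \<nu> = {\<pi>. map_pmf fst \<pi> = \<mu> \<and> map_pmf snd \<pi> = \<nu>}"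

text \<open>The transport cost is an ordinary expectation. It is finite in all cases considered here,
  because the marginals, and hence all couplings, have finite support.\<close>

definition wasserstein1 :: "('a \<Rightarrow> 'a \<Rightarrow> real) \<Rightarrow> 'a pmf \<Rightarrow> 'a pmf \<Rightarrow> real" where
  "wasserstein1 d \<mu> \<nu> =
     (INF \<pi>\<in>couplings \<mu> \<nu>. measure_pmf.expectation \<pi> (\<lambda>(x, y). d x y))"

definition kappa :: "'a set set \<Rightarrow> ('a set \<Rightarrow> real) \<Rightarrow> real \<Rightarrow> 'a \<Rightarrow> 'a \<Rightarrow> real" where
  "kappa E w \<alpha> x y =
     1 - wasserstein1 (\<lambda>a b. real (graph_dist E a b)) (lazy_walk E w \<alpha> x) (lazy_walk E w \<alpha> y)"

definition kappa_LLY :: "'a set set \<Rightarrow> ('a set \<Rightarrow> real) \<Rightarrow> 'a \<Rightarrow> 'a \<Rightarrow> real" where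
  "kappa_LLY E w x y = Lim (at_left 1) (\<lambda>\<alpha>. kappa E w \<alpha> x y / (1 - \<alpha>))"


section \<open>Admissible weights and distortion\<close>

text \<open>Weights are extensional functions on \<open>E\<close> (with value \<^const>\<open>undefined\<close> off \<open>E\<close>),
  so that equality of weights is equality of functions on \<open>E\<close>.\<close>

definition pos_weights :: "'a set set \<Rightarrow> ('a set \<Rightarrow> real) set" where
  "pos_weights E = E \<rightarrow>\<^sub>E {0<..}"

definition distortion :: "'a set set \<Rightarrow> ('a set \<Rightarrow> real) \<Rightarrow> ereal" where
  "distortion E w =
     (let S = (SUP e\<in>E. ereal (w e)); I = (INF e\<in>E. ereal (w e))
      in if S = \<infinity> \<or> I = 0 then \<infinity> else S / I)"

definition admissible :: "'a set set \<Rightarrow> ('a set \<Rightarrow> real) \<Rightarrow> bool" where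
  "admissible E w \<longleftrightarrow> w \<in> pos_weights E \<and> (\<forall>x y. {x, y} \<in> E \<longrightarrow> kappa_LLY E w x y \<ge> 0)"

text \<open>The infimum is taken in the extended reals, where the infimum of the empty set is \<open>\<infinity>\<close>.\<close>

definition DN_LLY :: "'a set set \<Rightarrow> ereal" where
  "DN_LLY E = (INF w\<in>{w. admissible E w}. distortion E w)"

definition optimal :: "'a set set \<Rightarrow> ('a set \<Rightarrow> real) \<Rightarrow> bool" where
  "optimal E w \<longleftrightarrow> admissible E w \<and> distortion E w = DN_LLY E"

definition normalized :: "'a set set \<Rightarrow> ('a set \<Rightarrow> real) \<Rightarrow> bool" where
  "normalized E w \<longleftrightarrow> distortion E w < \<infinity> \<and> (INF e\<in>E. w e) = 1"


section \<open>The fixed point map of a tree\<close>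

definition other_sum :: "'a set set \<Rightarrow> ('a set \<Rightarrow> real) \<Rightarrow> 'a \<Rightarrow> 'a set \<Rightarrow> real" where
  "other_sum E w u e = (\<Sum>f\<in>{f \<in> E. u \<in> f \<and> f \<noteq> e}. w f)"

text \<open>The product over the two ends of an edge makes the formula independent of their order.\<close>

definition tree_map :: "'a set set \<Rightarrow> ('a set \<Rightarrow> real) \<Rightarrow> ('a set \<Rightarrow> real)" where
  "tree_map E w = (\<lambda>e\<in>E. max 1 (sqrt (\<Prod>u\<in>e. other_sum E w u e)))"

lemma tree_map_edge:
  assumes "{u, v} \<in> E" "u \<noteq> v"
  shows "tree_map E w {u, v} = max 1 (sqrt (other_sum E w u {u, v} * other_sum E w v {u, v}))"
  using assms by (simp add: tree_map_def)

lemma tree_map_in: "tree_map E w \<in> E \<rightarrow>\<^sub>E {1..}"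
  by (auto simp: tree_map_def)

definition w_star :: "'a set set \<Rightarrow> ('a set \<Rightarrow> real)" where
  "w_star E = (THE w. w \<in> E \<rightarrow>\<^sub>E {1..} \<and> tree_map E w = w)"

end

theory Submission
  imports Defs
begin

text \<open>On a tree, optimal transport between the walks at the ends of an edge \<open>uv\<close> follows an explicit
  potential, which gives \<open>\<kappa>\<^sub>L\<^sub>L\<^sub>Y(u, v) = 2 w\<^sub>u\<^sub>v / d\<^sub>u + 2 w\<^sub>u\<^sub>v / d\<^sub>v - 2\<close>. Hence a weight is admissible iff
  \<open>w\<^sub>u\<^sub>v\<^sup>2 \<ge> A\<^sub>u\<^sub>|\<^sub>v A\<^sub>v\<^sub>|\<^sub>u\<close> on every edge, and the normalized admissible weights are supersolutions of
  the monotone map \<open>F\<^sub>T\<close>. A comparison principle (every subsolution lies below every supersolution)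
  gives uniqueness and minimality of the fixed point; the infimum of all supersolutions is one,
  and supersolutions exist by attaching leaves with small weights. If a normalized weight is optimal,
  it agrees with the fixed point on an edge of maximal weight, and the equality spreads through the
  non-pendant edges to the whole tree.\<close>

section \<open>Finite forests\<close>

lemma doubleton_card: "card e = 2 \<Longrightarrow> v \<in> e \<Longrightarrow> \<exists>u. u \<noteq> v \<and> e = {u, v}"
  by (auto simp: card_2_iff)

text \<open>Take a longest path and its first vertex \<open>v\<close>. A second edge at
  \<open>v\<close> would either prolong the path by a new vertex or return to a later vertex and
  close a cycle.\<close>

lemma leaf_exists:
  assumes fin: "finite S" and card: "\<And>e. e \<in> S \<Longrightarrow> card e = 2"
    and acyc: "\<And>xs. \<not> is_cycle S xs" and ne: "S \<noteq> {}"
  shows "\<exists>v. \<exists>e\<in>S. v \<in> e \<and> (\<forall>f\<in>S. v \<in> f \<longrightarrow> f = e)"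
proof -
  \<comment> \<open>\<open>P\<close> describes simple paths as vertex lists. Their vertices lie in
    the finite set \<open>\<Union>S\<close>, which bounds their length, so that a longest one
    exists.\<close>
  define P where "P xs \<longleftrightarrow> distinct xs \<and> set xs \<subseteq> \<Union>S \<and>
    (\<forall>i. Suc i < length xs \<longrightarrow> {xs ! i, xs ! Suc i} \<in> S)" for xs
  have fin': "finite (\<Union>S)"
    using fin card by (intro finite_Union) (auto intro!: card_ge_0_finite)
  have bound: "length xs \<le> card (\<Union>S)" if "P xs" for xs
    using that fin' unfolding P_def by (metis card_mono distinct_card)
  obtain e where "e \<in> S" using ne by auto
  then obtain a b where ab: "{a, b} \<in> S" "a \<noteq> b"
    using card by (metis card_2_iff)
  have Pab: "P [a, b]"
    using ab by (auto simp: P_def less_Suc_eq)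
  define xs where "xs = arg_max length P"
  have P: "P xs" and max: "\<And>ys. P ys \<Longrightarrow> length ys \<le> length xs"
    using arg_max_nat_lemma[of P "[a, b]" length "Suc (card (\<Union>S))"] Pab bound
    unfolding xs_def by (auto simp: less_Suc_eq_le)
  have len: "length xs \<ge> 2" using max[OF Pab] by simp
  define v where "v = xs ! 0"
  have e: "{v, xs ! 1} \<in> S" using P len by (auto simp: P_def v_def)
  have "f = {v, xs ! 1}" if f: "f \<in> S" "v \<in> f" for f
  proof (rule ccontr)
    assume neq: "f \<noteq> {v, xs ! 1}"
    obtain y where y: "y \<noteq> v" "f = {y, v}"
      using doubleton_card[OF card] f by metis
    show False
    proof (cases "y \<in> set xs")
      case False
      have "{(y # xs) ! i, (y # xs) ! Suc i} \<in> S" if "Suc i < length (y # xs)" for i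
        using that P f y by (cases i) (auto simp: P_def v_def)
      then have "P (y # xs)"
        using False P f y by (auto simp: P_def)
      from max[OF this] show False by simp
    next
      case True
      then obtain k where k: "k < length xs" "xs ! k = y"
        by (auto simp: in_set_conv_nth)
      \<comment> \<open>The closing cycle must have at least three vertices: \<open>k = 0\<close>
        would make \<open>f\<close> a loop, and \<open>k = 1\<close> would make \<open>f\<close> the
        path's own first edge.\<close>
      have k2: "k \<ge> 2"
      proof (rule ccontr)
        assume "\<not> k \<ge> 2"
        then have "k = 0 \<or> k = 1" by auto
        then show False using k y neq by (auto simp: v_def insert_commute)
      qed
      \<comment> \<open>The path from \<open>v\<close> to \<open>y\<close> is closed by
        \<open>f\<close>: at \<open>i = k\<close> the index \<open>Suc i mod Suc k\<close> wraps
        around to \<open>0\<close>, that is, to \<open>v\<close>.\<close>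
      have "{take (Suc k) xs ! i, take (Suc k) xs ! (Suc i mod Suc k)} \<in> S" if "i < Suc k" for i
      proof (cases "i = k")
        case True
        then show ?thesis using k y f by (simp add: v_def)
      next
        case False
        then show ?thesis using that k P by (simp add: P_def)
      qed
      moreover have "length (take (Suc k) xs) = Suc k" using k by simp
      ultimately have "is_cycle S (take (Suc k) xs)"
        using k k2 P by (simp add: is_cycle_def P_def)
      then show False using acyc by simp
    qed
  qed
  then show ?thesis using e by blast
qed

lemma is_cycle_mono: "is_cycle S xs \<Longrightarrow> S \<subseteq> T \<Longrightarrow> is_cycle T xs"
  by (auto simp: is_cycle_def)

section \<open>Order and scaling properties of the sums over the other edges at a vertex\<close>

lemma other_sum_mono:
  assumes "\<And>f. f \<in> E \<Longrightarrow> x f \<le> z f"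
  shows "other_sum E x u e \<le> other_sum E z u e"
  unfolding other_sum_def using assms by (intro sum_mono) auto

lemma other_sum_nonneg:
  assumes "\<And>f. f \<in> E \<Longrightarrow> 0 \<le> z f"
  shows "0 \<le> other_sum E z u e"
  unfolding other_sum_def using assms by (intro sum_nonneg) auto

lemma other_sum_cmult:
  assumes "\<And>f. f \<in> E \<Longrightarrow> z f = c * w f"
  shows "other_sum E z u e = c * other_sum E w u e"
  unfolding other_sum_def sum_distrib_left using assms by (intro sum.cong) auto

lemma other_sum_eq_imp:
  assumes "finite E" "\<And>f. f \<in> E \<Longrightarrow> x f \<le> z f"
    and "other_sum E x u e = other_sum E z u e" and "f \<in> E" "u \<in> f" "f \<noteq> e"
  shows "x f = z f"
  using assms unfolding other_sum_def
  by (intro sum_mono_inv[of x "{f \<in> E. u \<in> f \<and> f \<noteq> e}" z]) auto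

text \<open>Induction on the number of edges: remove a leaf edge \<open>e\<close>, solve the rest,
  and restore \<open>e\<close> with a small weight \<open>t\<close>. At \<open>e\<close> the product
  vanishes because of the leaf. The other inequalities survive a small perturbation because they are
  strict, which is why strictness is carried through the induction.\<close>

lemma strict_supersolution_exists:
  assumes "finite S" and "\<And>e. e \<in> S \<Longrightarrow> card e = 2" and "\<And>xs. \<not> is_cycle S xs"
  shows "\<exists>x. (\<forall>e\<in>S. 0 < x e) \<and>
    (\<forall>a b. {a, b} \<in> S \<longrightarrow> other_sum S x a {a, b} * other_sum S x b {a, b} < (x {a, b})\<^sup>2)"
  using assms
proof (induction "card S" arbitrary: S)
  case 0
  then show ?case by auto
next
  case (Suc n)
  then have "S \<noteq> {}" by auto
  from leaf_exists[OF Suc.prems this] obtain v e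
    where v: "e \<in> S" "v \<in> e" "\<forall>f\<in>S. v \<in> f \<longrightarrow> f = e" by blast
  define R where "R = S - {e}"
  have "finite R" "e \<notin> R" using Suc.prems by (auto simp: R_def)
  have S: "S = insert e R" using v(1) by (auto simp: R_def)
  have card2: "\<And>f. f \<in> R \<Longrightarrow> card f = 2" using Suc.prems(2) by (simp add: R_def)
  have acyc: "\<not> is_cycle R xs" for xs
    using is_cycle_mono[of R xs S] Suc.prems(3) by (auto simp: R_def)
  have "n = card R" using Suc.hyps(2) v(1) Suc.prems(1) by (simp add: R_def)
  from Suc.hyps(1)[OF this \<open>finite R\<close> card2 acyc] obtain x
    where x: "\<And>f. f \<in> R \<Longrightarrow> 0 < x f"
    "\<And>a b. {a, b} \<in> R \<Longrightarrow> other_sum R x a {a, b} * other_sum R x b {a, b} < (x {a, b})\<^sup>2"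
    by blast
  \<comment> \<open>Restoring \<open>e\<close> with weight \<open>t\<close> raises the sum at
    \<open>a\<close> by \<open>t\<close> exactly if \<open>a\<close> is an end of
    \<open>e\<close>.\<close>
  have os: "other_sum S (x(e := t)) a f = other_sum R x a f + t * of_bool (a \<in> e)"
    if "f \<in> R" for t a f
  proof -
    have "{g \<in> S. a \<in> g \<and> g \<noteq> f} = (if a \<in> e then insert e {g \<in> R. a \<in> g \<and> g \<noteq> f}
        else {g \<in> R. a \<in> g \<and> g \<noteq> f})"
      using that \<open>e \<notin> R\<close> by (auto simp: S)
    moreover have "(\<Sum>g\<in>{g \<in> R. a \<in> g \<and> g \<noteq> f}. (x(e := t)) g) = other_sum R x a f"
      unfolding other_sum_def using \<open>e \<notin> R\<close> by (intro sum.cong) auto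
    ultimately show ?thesis
      using \<open>finite R\<close> \<open>e \<notin> R\<close> by (simp add: other_sum_def)
  qed
  \<comment> \<open>Each product is continuous in \<open>t\<close> and satisfies the strict bound at
    \<open>t = 0\<close>. As \<open>R\<close> is finite, one positive \<open>t\<close> serves all
    its edges.\<close>
  have ev: "eventually (\<lambda>t. \<forall>f\<in>R. (\<Prod>a\<in>f. other_sum R x a f + t * of_bool (a \<in> e)) < (x f)\<^sup>2)
      (at_right 0)"
  proof (intro eventually_ball_finite ballI \<open>finite R\<close>)
    fix f assume f: "f \<in> R"
    then obtain a b where ab: "f = {a, b}" "a \<noteq> b"
      using Suc.prems(2)[of f] by (auto simp: R_def card_2_iff)
    have "((\<lambda>t. \<Prod>a\<in>f. other_sum R x a f + t * of_bool (a \<in> e)) \<longlongrightarrow>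
        (\<Prod>a\<in>f. other_sum R x a f + 0 * of_bool (a \<in> e))) (at_right 0)"
      by (intro tendsto_intros)
    moreover have "(\<Prod>a\<in>f. other_sum R x a f + 0 * of_bool (a \<in> e)) < (x f)\<^sup>2"
      using x(2)[of a b] ab f by simp
    ultimately show "eventually (\<lambda>t. (\<Prod>a\<in>f. other_sum R x a f + t * of_bool (a \<in> e)) < (x f)\<^sup>2)
      (at_right 0)"
      by (rule order_tendstoD(2))
  qed
  then obtain t where t: "t > 0"
    "\<forall>f\<in>R. (\<Prod>a\<in>f. other_sum R x a f + t * of_bool (a \<in> e)) < (x f)\<^sup>2"
    using eventually_happens'[OF _ eventually_conj[OF ev eventually_at_right_less]] by auto
  show ?case
  proof (intro exI[of _ "x(e := t)"] conjI ballI allI impI)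
    fix f assume "f \<in> S"
    then show "0 < (x(e := t)) f" using x(1) t by (auto simp: S)
  next
    fix a b assume ab: "{a, b} \<in> S"
    have ne: "a \<noteq> b" using Suc.prems(2)[OF ab] by auto
    show "other_sum S (x(e := t)) a {a, b} * other_sum S (x(e := t)) b {a, b} < ((x(e := t)) {a, b})\<^sup>2"
    proof (cases "{a, b} = e")
      case True
      have "other_sum S (x(e := t)) v e = 0"
        using v(3) by (force simp: other_sum_def intro!: sum.neutral)
      moreover have "v = a \<or> v = b" using v(2) True by auto
      ultimately have zero: "other_sum S (x(e := t)) a e * other_sum S (x(e := t)) b e = 0"
        by auto
      show ?thesis unfolding True zero using t(1) by simp
    next
      case False
      then have R: "{a, b} \<in> R" using ab by (simp add: R_def)
      then show ?thesis using t(2) os[OF R] False ne by force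
    qed
  qed
qed

section \<open>Comparison principle and the fixed point of the tree map\<close>

locale finite_forest =
  fixes E :: "'a set set"
  assumes finite_E: "finite E"
    and card_E: "e \<in> E \<Longrightarrow> card e = 2"
    and acyclic_E: "\<not> is_cycle E xs"
begin

lemma edge_neq: "{u, v} \<in> E \<Longrightarrow> u \<noteq> v"
  using card_E by fastforce

lemma edgeE:
  assumes "e \<in> E"
  obtains u v where "e = {u, v}" "u \<noteq> v"
  using card_E[OF assms] by (auto simp: card_2_iff)

text \<open>Since \<open>z {u, v}\<close> is at least 1, the constant 1 in the maximum imposes
  nothing. This links supersolutions of \<open>tree_map\<close> with the quadratic form of
  nonnegative curvature.\<close>

lemma tree_map_le_iff:
  assumes "{u, v} \<in> E" "1 \<le> z {u, v}" "\<And>f. f \<in> E \<Longrightarrow> 0 \<le> z f"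
  shows "tree_map E z {u, v} \<le> z {u, v} \<longleftrightarrow>
    other_sum E z u {u, v} * other_sum E z v {u, v} \<le> (z {u, v})\<^sup>2"
  using assms(2) tree_map_edge[OF assms(1) edge_neq[OF assms(1)], of z]
  by (auto intro: real_le_lsqrt sqrt_le_D)

lemma tree_map_mono:
  assumes "\<And>f. f \<in> E \<Longrightarrow> 0 \<le> x f" "\<And>f. f \<in> E \<Longrightarrow> x f \<le> z f" "e \<in> E"
  shows "tree_map E x e \<le> tree_map E z e"
proof -
  have "(\<Prod>u\<in>e. other_sum E x u e) \<le> (\<Prod>u\<in>e. other_sum E z u e)"
    using assms by (intro prod_mono conjI other_sum_nonneg other_sum_mono) auto
  then show ?thesis using assms(3) by (auto simp: tree_map_def intro: max.coboundedI2)
qed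

text \<open>Let \<open>l > 1\<close> be the maximal ratio \<open>x / z\<close>. Where it is attained, both sums in \<open>tree_map\<close>
  are positive and must scale by \<open>l\<close> as well, so every adjacent edge attains it too. Hence the set
  of these edges has no leaf.\<close>

lemma subsolution_le_supersolution:
  assumes x: "\<And>e. e \<in> E \<Longrightarrow> 0 \<le> x e" "\<And>e. e \<in> E \<Longrightarrow> x e \<le> tree_map E x e"
    and z: "\<And>e. e \<in> E \<Longrightarrow> 1 \<le> z e" "\<And>e. e \<in> E \<Longrightarrow> tree_map E z e \<le> z e"
    and e: "e \<in> E"
  shows "x e \<le> z e"
proof (rule ccontr)
  assume nle: "\<not> x e \<le> z e"
  have zpos: "0 < z f" if "f \<in> E" for f using z(1)[OF that] by simp
  define l where "l = Max ((\<lambda>f. x f / z f) ` E)"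
  have "x f / z f \<le> l" if "f \<in> E" for f
    using that finite_E by (auto simp: l_def)
  then have le: "x f \<le> l * z f" if "f \<in> E" for f
    using that zpos[OF that] by (simp add: divide_le_eq)
  have "1 < x e / z e" using nle zpos[OF e] by simp
  also have "\<dots> \<le> l" using e finite_E by (auto simp: l_def)
  finally have l: "1 < l" .
  define S where "S = {f \<in> E. x f = l * z f}"
  have "l \<in> (\<lambda>f. x f / z f) ` E"
    unfolding l_def using e finite_E by (intro Max_in) auto
  then have "S \<noteq> {}" using zpos by (fastforce simp: S_def field_simps)
  have "\<not> is_cycle S xs" for xs
    using is_cycle_mono[of S xs E] acyclic_E by (auto simp: S_def)
  from leaf_exists[of S, OF _ _ this \<open>S \<noteq> {}\<close>] obtain v f
    where f: "f \<in> S" "v \<in> f" and leaf: "\<And>g. g \<in> S \<Longrightarrow> v \<in> g \<Longrightarrow> g = f"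
    using finite_E card_E unfolding S_def by (metis (no_types, lifting) finite_subset mem_Collect_eq subsetI)
  have fE: "f \<in> E" and xf: "x f = l * z f" using f by (auto simp: S_def)
  obtain u where u: "u \<noteq> v" "f = {u, v}"
    using doubleton_card[OF card_E[OF fE] f(2)] by (metis insert_commute)
  define ax bx az bz where "ax = other_sum E x u f" and "bx = other_sum E x v f"
    and "az = other_sum E z u f" and "bz = other_sum E z v f"
  have lz: "other_sum E (\<lambda>g. l * z g) w f = l * other_sum E z w f" for w
    by (rule other_sum_cmult) simp
  have ab: "0 \<le> ax" "0 \<le> bx" "ax \<le> l * az" "bx \<le> l * bz" "0 \<le> az" "0 \<le> bz"
    unfolding ax_def bx_def az_def bz_def lz[symmetric]
    using x(1) zpos le by (auto intro!: other_sum_nonneg other_sum_mono simp: less_imp_le)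
  \<comment> \<open>At \<open>f\<close> the value \<open>x f\<close> exceeds 1, so the constant
    branch of the maximum cannot account for it and the square root must bound
    \<open>x f\<close>.\<close>
  have "l * 1 \<le> l * z f"
    using z(1)[OF fE] l by (intro mult_left_mono) auto
  then have "1 < x f" using xf l by linarith
  then have "x f \<le> sqrt (ax * bx)"
    using x(2)[OF fE] tree_map_edge[of u v E x] u fE by (auto simp: ax_def bx_def)
  moreover from z(2)[OF fE] have "sqrt (az * bz) \<le> z f"
    using tree_map_edge[of u v E z] u fE by (auto simp: az_def bz_def)
  then have "l * sqrt (az * bz) \<le> l * z f" using l by simp
  ultimately have "l * sqrt (az * bz) \<le> sqrt (ax * bx)" using xf by linarith
  then have "(l * sqrt (az * bz))\<^sup>2 \<le> (sqrt (ax * bx))\<^sup>2"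
    using ab l by (intro power_mono) auto
  then have sq: "(l * az) * (l * bz) \<le> ax * bx"
    using ab by (simp add: power_mult_distrib power2_eq_square mult_ac)
  have "0 < ax * bx"
    using \<open>1 < x f\<close> \<open>x f \<le> sqrt (ax * bx)\<close> by (metis less_le_trans less_trans real_sqrt_gt_0_iff zero_less_one)
  then have pos: "0 < ax" "0 < bx" using ab by (auto simp: zero_less_mult_iff)
  \<comment> \<open>The factors obey \<open>ax \<le> l * az\<close> and
    \<open>bx \<le> l * bz\<close>, while \<open>sq\<close> bounds the products the other way. As
    \<open>ax\<close> is positive, there is no slack at \<open>v\<close>.\<close>
  have "bx = l * bz"
  proof (rule ccontr)
    assume "bx \<noteq> l * bz"
    then have "bx < l * bz" using ab by simp
    then have "ax * bx < ax * (l * bz)" using pos by simp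
    also have "\<dots> \<le> (l * az) * (l * bz)" using ab l by (intro mult_right_mono) auto
    finally show False using sq by simp
  qed
  then have eq: "other_sum E x v f = other_sum E (\<lambda>g. l * z g) v f"
    by (simp add: bx_def bz_def lz)
  \<comment> \<open>A second edge at \<open>v\<close> exists because \<open>bx\<close> is positive.
    Equality of the sums puts it into \<open>S\<close>, against the choice of the leaf
    \<open>v\<close>.\<close>
  have "{g \<in> E. v \<in> g \<and> g \<noteq> f} \<noteq> {}"
  proof
    assume none: "{g \<in> E. v \<in> g \<and> g \<noteq> f} = {}"
    have "bx = 0" unfolding bx_def other_sum_def none by simp
    then show False using pos by simp
  qed
  then obtain g where g: "g \<in> E" "v \<in> g" "g \<noteq> f" by auto
  have "x g = l * z g"
    using other_sum_eq_imp[OF finite_E le eq g] .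
  then show False using leaf[of g] g by (simp add: S_def)
qed

text \<open>Both sides of the edge inequality are homogeneous of degree 2, so a positive solution
  may be divided by its minimum \<open>m\<close> to make all values at least 1.\<close>

lemma supersolution_exists:
  "\<exists>z. z \<in> E \<rightarrow>\<^sub>E {1..} \<and> (\<forall>e\<in>E. tree_map E z e \<le> z e)"
proof (cases "E = {}")
  case False
  obtain x where x: "\<And>e. e \<in> E \<Longrightarrow> 0 < x e"
    "\<And>a b. {a, b} \<in> E \<Longrightarrow> other_sum E x a {a, b} * other_sum E x b {a, b} < (x {a, b})\<^sup>2"
    using strict_supersolution_exists[OF finite_E card_E acyclic_E] by blast
  define m where "m = Min (x ` E)"
  have m: "0 < m" using finite_E False x(1) by (simp add: m_def)
  have mle: "m \<le> x e" if "e \<in> E" for e using that finite_E by (simp add: m_def)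
  define z where "z = (\<lambda>e\<in>E. (1 / m) * x e)"
  have z1: "1 \<le> z e" if "e \<in> E" for e using that m mle[OF that] by (simp add: z_def)
  have os: "other_sum E z u e = (1 / m) * other_sum E x u e" for u e
    by (rule other_sum_cmult) (simp add: z_def)
  have "tree_map E z e \<le> z e" if "e \<in> E" for e
  proof -
    obtain u v where uv: "e = {u, v}" "u \<noteq> v" using edgeE[OF \<open>e \<in> E\<close>] .
    have "other_sum E x u e * other_sum E x v e / m\<^sup>2 \<le> (x e)\<^sup>2 / m\<^sup>2"
      using x(2)[of u v] that uv m by (intro divide_right_mono) auto
    then have "other_sum E z u e * other_sum E z v e \<le> (z e)\<^sup>2"
      unfolding os using that by (simp add: z_def power2_eq_square)
    then show ?thesis
      using tree_map_le_iff[of u v z] that z1 uv by (auto intro: order_trans[OF zero_le_one])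
  qed
  then show ?thesis using z1 by (intro exI[of _ z]) (auto simp: z_def)
qed auto

text \<open>Existence is the Knaster-Tarski argument: the pointwise infimum of the set
  \<open>Z\<close> of supersolutions is a fixed point. For uniqueness, a fixed point is both a
  subsolution and a supersolution, so the comparison principle applies in both directions.\<close>

lemma fixed_point_ex1: "\<exists>!w. w \<in> E \<rightarrow>\<^sub>E {1..} \<and> tree_map E w = w"
proof -
  define Z where "Z = {z. z \<in> E \<rightarrow>\<^sub>E {1..} \<and> (\<forall>e\<in>E. tree_map E z e \<le> z e)}"
  have Zne: "Z \<noteq> {}" using supersolution_exists by (auto simp: Z_def)
  define w where "w = (\<lambda>e\<in>E. INF z\<in>Z. z e)"
  have bdd: "bdd_below ((\<lambda>z. z e) ` Z)" if "e \<in> E" for e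
    using that by (intro bdd_belowI[of _ 1]) (auto simp: Z_def PiE_def)
  have w1: "1 \<le> w e" if "e \<in> E" for e
    using that Zne by (auto simp: w_def Z_def PiE_def intro!: cINF_greatest)
  have wle: "w e \<le> z e" if "e \<in> E" "z \<in> Z" for e z
    using that bdd by (auto simp: w_def intro: cINF_lower)
  have Fw: "tree_map E w e \<le> w e" if "e \<in> E" for e
  proof -
    have "tree_map E w e \<le> z e" if "z \<in> Z" for z
    proof -
      have "tree_map E w e \<le> tree_map E z e"
        using w1 wle[OF _ that] \<open>e \<in> E\<close> by (intro tree_map_mono) (auto intro: order_trans[OF zero_le_one])
      also have "\<dots> \<le> z e" using that \<open>e \<in> E\<close> by (simp add: Z_def)
      finally show ?thesis .
    qed
    then show ?thesis using Zne that by (auto simp: w_def intro!: cINF_greatest)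
  qed
  have F1: "1 \<le> tree_map E w e" if "e \<in> E" for e
    using that by (simp add: tree_map_def)
  \<comment> \<open>Applying the monotone map to \<open>tree_map E w \<le> w\<close> shows that
    \<open>tree_map E w\<close> is again a supersolution, so the infimum \<open>w\<close> lies below
    it.\<close>
  have "tree_map E w \<in> Z"
    using Fw F1 by (auto simp: Z_def tree_map_in intro!: tree_map_mono order_trans[OF zero_le_one])
  then have "w e \<le> tree_map E w e" if "e \<in> E" for e using wle that by simp
  then have fix_w: "tree_map E w = w"
    using Fw by (intro extensionalityI[of _ E]) (auto simp: w_def tree_map_def intro: order.antisym)
  moreover have "w \<in> E \<rightarrow>\<^sub>E {1..}" using w1 by (auto simp: w_def)
  moreover have "x e \<le> y e" if x: "x \<in> E \<rightarrow>\<^sub>E {1..}" "tree_map E x = x"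
    and y: "y \<in> E \<rightarrow>\<^sub>E {1..}" "tree_map E y = y" and e: "e \<in> E" for x y e
  proof (rule subsolution_le_supersolution[OF _ _ _ _ e])
    fix f assume "f \<in> E"
    with x(1) y(1) have "1 \<le> x f" "1 \<le> y f" by (auto simp: PiE_iff)
    then show "0 \<le> x f" "1 \<le> y f" by simp_all
  qed (use x y in simp_all)
  then have "x = y" if "x \<in> E \<rightarrow>\<^sub>E {1..} \<and> tree_map E x = x"
    "y \<in> E \<rightarrow>\<^sub>E {1..} \<and> tree_map E y = y" for x y
    using that by (intro PiE_ext[of x E _ y]) (auto intro: order.antisym)
  ultimately show ?thesis by blast
qed

lemma w_star_in: "w_star E \<in> E \<rightarrow>\<^sub>E {1..}" and tree_map_w_star: "tree_map E (w_star E) = w_star E"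
  using theI'[OF fixed_point_ex1] unfolding w_star_def by blast+

end

section \<open>Wasserstein distance through a potential\<close>

text \<open>The common mass \<open>c\<close> stays on the diagonal. The surplus \<open>r\<close> of
  \<open>\<mu>\<close> is sent to the surplus \<open>t\<close> of \<open>\<nu>\<close> by a
  normalized product, so mass moves only from points where \<open>\<mu>\<close> is larger to points
  where \<open>\<nu>\<close> is larger.\<close>

lemma maximal_coupling:
  fixes \<mu> \<nu> :: "'a pmf"
  assumes fin: "finite (set_pmf \<mu>)" "finite (set_pmf \<nu>)"
  shows "\<exists>\<pi>\<in>couplings \<mu> \<nu>. \<forall>a b. (a, b) \<in> set_pmf \<pi> \<longrightarrow>
    a = b \<or> pmf \<nu> a < pmf \<mu> a \<and> pmf \<mu> b < pmf \<nu> b"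
proof -
  define S where "S = set_pmf \<mu> \<union> set_pmf \<nu>"
  define c where "c x = min (pmf \<mu> x) (pmf \<nu> x)" for x
  define r where "r x = pmf \<mu> x - c x" for x
  define t where "t x = pmf \<nu> x - c x" for x
  define R where "R = 1 - sum c S"
  define g where "g = (\<lambda>(a, b). (if a = b then c a else 0) + r a * t b / R)"
  have S: "finite S" using fin by (simp add: S_def)
  have out: "c x = 0" "r x = 0" "t x = 0" if "x \<notin> S" for x
    using that by (auto simp: S_def c_def r_def t_def set_pmf_iff)
  have nn: "0 \<le> c x" "0 \<le> r x" "0 \<le> t x" for x
    by (auto simp: c_def r_def t_def)
  have "sum (pmf \<mu>) S = 1" "sum (pmf \<nu>) S = 1"
    using S by (auto simp: S_def intro!: sum_pmf_eq_1)
  then have sums: "sum r S = R" "sum t S = R"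
    by (simp_all add: r_def t_def R_def sum_subtractf)
  have R: "0 \<le> R" using sum_nonneg[of S r] nn sums by simp
  \<comment> \<open>If \<open>R = 0\<close>, division yields 0; then \<open>r\<close> and
    \<open>t\<close> vanish on \<open>S\<close>, so the formula remains correct for equal
    measures.\<close>
  have r0: "r x * R / R = r x" and t0: "R * t x / R = t x" if "x \<in> S" for x
    using sum_nonneg_eq_0_iff[OF S, of r] sum_nonneg_eq_0_iff[OF S, of t] nn sums that
    by (cases "R = 0"; force)+
  have gnn: "0 \<le> g p" for p using nn R by (auto simp: g_def split: prod.splits)
  have gout: "g (a, b) = 0" if "a \<notin> S \<or> b \<notin> S" for a b
    using that out by (auto simp: g_def)
  have gin: "a \<in> S" "b \<in> S" if "g (a, b) \<noteq> 0" for a b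
    using that gout by blast+
  have row: "(\<Sum>b\<in>S. g (a, b)) = pmf \<mu> a" if "a \<in> S" for a
  proof -
    have "(\<Sum>b\<in>S. g (a, b)) = c a + r a * sum t S / R"
      using S that by (simp add: g_def sum.distrib sum.delta sum_distrib_left sum_divide_distrib)
    also have "\<dots> = pmf \<mu> a" using r0[OF that] sums by (simp add: r_def)
    finally show ?thesis .
  qed
  have col: "(\<Sum>a\<in>S. g (a, b)) = pmf \<nu> b" if "b \<in> S" for b
  proof -
    have "(\<Sum>a\<in>S. g (a, b)) = c b + sum r S * t b / R"
      using S that by (simp add: g_def sum.distrib sum.delta' sum_distrib_right sum_divide_distrib)
    also have "\<dots> = pmf \<nu> b" using t0[OF that] sums by (simp add: t_def)
    finally show ?thesis .
  qed
  define \<pi> where "\<pi> = embed_pmf g"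
  have "(\<Sum>p\<in>S \<times> S. g p) = (\<Sum>a\<in>S. \<Sum>b\<in>S. g (a, b))"
    by (simp add: sum.cartesian_product)
  also have "\<dots> = 1" using row \<open>sum (pmf \<mu>) S = 1\<close> by simp
  finally have total: "(\<Sum>p\<in>S \<times> S. g p) = 1" .
  have "(\<integral>\<^sup>+ p. ennreal (g p) \<partial>count_space UNIV) = (\<Sum>p\<in>S \<times> S. ennreal (g p))"
    using S by (intro nn_integral_count_space') (auto, (metis gin ennreal_0)+)
  also have "\<dots> = 1" using gnn total by (simp add: sum_ennreal)
  finally have pmf: "pmf \<pi> p = g p" for p
    unfolding \<pi>_def using gnn by (intro pmf_embed_pmf) auto
  have "pmf (map_pmf fst \<pi>) a = pmf \<mu> a" for a
  proof -
    have "pmf (map_pmf fst \<pi>) a = measure_pmf.prob \<pi> ({a} \<times> S)"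
      unfolding pmf_map by (intro measure_prob_cong_0) (auto simp: pmf intro: gin)
    also have "\<dots> = (\<Sum>b\<in>S. g (a, b))"
      using S by (simp add: measure_measure_pmf_finite pmf sum.cartesian_product')
    also have "\<dots> = pmf \<mu> a"
      using row gout by (cases "a \<in> S") (auto simp: S_def set_pmf_iff)
    finally show ?thesis .
  qed
  moreover have "pmf (map_pmf snd \<pi>) b = pmf \<nu> b" for b
  proof -
    have "pmf (map_pmf snd \<pi>) b = measure_pmf.prob \<pi> (S \<times> {b})"
      unfolding pmf_map by (intro measure_prob_cong_0) (auto simp: pmf intro: gin)
    also have "\<dots> = (\<Sum>a\<in>S. g (a, b))"
      using S by (simp add: measure_measure_pmf_finite pmf sum.cartesian_product')
    also have "\<dots> = pmf \<nu> b"
      using col gout by (cases "b \<in> S") (auto simp: S_def set_pmf_iff)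
    finally show ?thesis .
  qed
  ultimately have "\<pi> \<in> couplings \<mu> \<nu>"
    by (simp add: couplings_def pmf_eq_iff)
  moreover have "pmf \<nu> a < pmf \<mu> a \<and> pmf \<mu> b < pmf \<nu> b" if "(a, b) \<in> set_pmf \<pi>" "a \<noteq> b" for a b
  proof -
    have "r a \<noteq> 0" "t b \<noteq> 0" using that by (auto simp: set_pmf_iff pmf g_def)
    then show ?thesis by (auto simp: r_def t_def c_def min_def split: if_splits)
  qed
  ultimately show ?thesis by blast
qed

lemma coupling_supports:
  assumes "\<pi> \<in> couplings \<mu> \<nu>" "(a, b) \<in> set_pmf \<pi>"
  shows "a \<in> set_pmf \<mu>" "b \<in> set_pmf \<nu>"
  using assms by (force simp: couplings_def)+

lemma finite_coupling:
  assumes "\<pi> \<in> couplings \<mu> \<nu>" "finite (set_pmf \<mu>)" "finite (set_pmf \<nu>)"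
  shows "finite (set_pmf \<pi>)"
proof (rule finite_subset)
  show "set_pmf \<pi> \<subseteq> set_pmf \<mu> \<times> set_pmf \<nu>" using coupling_supports[OF assms(1)] by auto
qed (use assms in auto)

lemma expectation_coupling_diff:
  fixes f :: "'a \<Rightarrow> real"
  assumes \<pi>: "\<pi> \<in> couplings \<mu> \<nu>" and fin: "finite (set_pmf \<mu>)" "finite (set_pmf \<nu>)"
  shows "measure_pmf.expectation \<pi> (\<lambda>(a, b). f a - f b) =
    measure_pmf.expectation \<mu> f - measure_pmf.expectation \<nu> f"
proof -
  have [simp]: "integrable (measure_pmf \<pi>) h" for h :: "'a \<times> 'a \<Rightarrow> real"
    using finite_coupling[OF assms] by (rule integrable_measure_pmf_finite)
  have "measure_pmf.expectation \<pi> (\<lambda>(a, b). f a - f b) =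
      measure_pmf.expectation \<pi> (\<lambda>p. f (fst p)) - measure_pmf.expectation \<pi> (\<lambda>p. f (snd p))"
    by (simp add: case_prod_unfold)
  also have "\<dots> = measure_pmf.expectation (map_pmf fst \<pi>) f - measure_pmf.expectation (map_pmf snd \<pi>) f"
    by simp
  finally show ?thesis using \<pi> by (auto simp: couplings_def simp del: integral_map_pmf)
qed

text \<open>The easy half of Kantorovich duality bounds the cost of every coupling from below by the
  difference of the expectations of \<open>f\<close>. The maximal coupling attains this bound: its
  diagonal part costs nothing, and its other moves are \<open>tight\<close>.\<close>

lemma wasserstein1_eq_potential_diff:
  fixes d :: "'a \<Rightarrow> 'a \<Rightarrow> real" and f :: "'a \<Rightarrow> real"
  assumes fin: "finite (set_pmf \<mu>)" "finite (set_pmf \<nu>)"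
    and lip: "\<And>a b. a \<in> set_pmf \<mu> \<Longrightarrow> b \<in> set_pmf \<nu> \<Longrightarrow> f a - f b \<le> d a b"
    and refl: "\<And>a. d a a = 0"
    and tight: "\<And>a b. pmf \<nu> a < pmf \<mu> a \<Longrightarrow> pmf \<mu> b < pmf \<nu> b \<Longrightarrow> d a b = f a - f b"
  shows "wasserstein1 d \<mu> \<nu> = measure_pmf.expectation \<mu> f - measure_pmf.expectation \<nu> f"
  unfolding wasserstein1_def
proof (rule cInf_eq_minimum)
  obtain \<pi> where \<pi>: "\<pi> \<in> couplings \<mu> \<nu>"
    "\<And>a b. (a, b) \<in> set_pmf \<pi> \<Longrightarrow> a = b \<or> pmf \<nu> a < pmf \<mu> a \<and> pmf \<mu> b < pmf \<nu> b"
    using maximal_coupling[OF fin] by blast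
  have "measure_pmf.expectation \<pi> (\<lambda>(a, b). d a b) = measure_pmf.expectation \<pi> (\<lambda>(a, b). f a - f b)"
    using \<pi>(2) tight refl by (intro integral_cong_AE) (fastforce simp: AE_measure_pmf_iff)+
  then show "measure_pmf.expectation \<mu> f - measure_pmf.expectation \<nu> f \<in>
      (\<lambda>\<pi>. measure_pmf.expectation \<pi> (\<lambda>(a, b). d a b)) ` couplings \<mu> \<nu>"
    using \<pi>(1) expectation_coupling_diff[OF \<pi>(1) fin, of f] by (intro image_eqI[of _ _ \<pi>]) auto
next
  fix x assume "x \<in> (\<lambda>\<pi>. measure_pmf.expectation \<pi> (\<lambda>(a, b). d a b)) ` couplings \<mu> \<nu>"
  then obtain \<pi> where \<pi>: "\<pi> \<in> couplings \<mu> \<nu>" "x = measure_pmf.expectation \<pi> (\<lambda>(a, b). d a b)"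
    by blast
  have "measure_pmf.expectation \<pi> (\<lambda>(a, b). f a - f b) \<le> x"
    unfolding \<pi>(2) using lip coupling_supports[OF \<pi>(1)] finite_coupling[OF \<pi>(1) fin]
    by (intro integral_mono_AE integrable_measure_pmf_finite) (auto simp: AE_measure_pmf_iff)
  then show "measure_pmf.expectation \<mu> f - measure_pmf.expectation \<nu> f \<le> x"
    using expectation_coupling_diff[OF \<pi>(1) fin, of f] by simp
qed

section \<open>Curvature of forests\<close>

lemma graph_dist_eqI:
  assumes "(a, b) \<in> adj_rel E ^^ n" "\<And>m. m < n \<Longrightarrow> (a, b) \<notin> adj_rel E ^^ m"
  shows "graph_dist E a b = n"
  unfolding graph_dist_def using assms by (intro Least_equality) (auto simp: not_less[symmetric])

lemma graph_dist_self: "graph_dist E a a = 0"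
  by (rule graph_dist_eqI) auto

lemma mem_adj_rel: "(a, b) \<in> adj_rel E \<longleftrightarrow> {a, b} \<in> E"
  by (simp add: adj_rel_def)

lemma adj_rel_pow_2: "(a, b) \<in> adj_rel E ^^ 2 \<longleftrightarrow> (\<exists>c. {a, c} \<in> E \<and> {c, b} \<in> E)"
  by (auto simp: numeral_2_eq_2 relcomp_unfold mem_adj_rel)

lemma adj_rel_pow_3: "(a, b) \<in> adj_rel E ^^ 3 \<longleftrightarrow> (\<exists>c d. {a, c} \<in> E \<and> {c, d} \<in> E \<and> {d, b} \<in> E)"
  by (auto simp: numeral_3_eq_3 relcomp_unfold mem_adj_rel)

text \<open>A Kantorovich potential for the pair \<open>u, v\<close>, meaningful only on \<open>u\<close>, \<open>v\<close> and their neighbours: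
  it falls by exactly the distance along every move of mass except the one from \<open>v\<close> to \<open>u\<close>.\<close>

definition potential :: "'a set set \<Rightarrow> 'a \<Rightarrow> 'a \<Rightarrow> 'a \<Rightarrow> real" where
  "potential E u v x = (if x = u then 0 else if x = v then -1 else if x \<in> nbrs E u then 1 else -2)"

context finite_forest
begin

section \<open>Distances near an edge of a forest\<close>

lemma no_triangle: "{a, b} \<in> E \<Longrightarrow> {b, c} \<in> E \<Longrightarrow> {c, a} \<in> E \<Longrightarrow> False"
  using acyclic_E[of "[a, b, c]"] edge_neq[of a b] edge_neq[of b c] edge_neq[of c a]
  by (auto simp: is_cycle_def less_Suc_eq insert_commute)

lemma no_4_cycle:
  "{a, b} \<in> E \<Longrightarrow> {b, c} \<in> E \<Longrightarrow> {c, d} \<in> E \<Longrightarrow> {d, a} \<in> E \<Longrightarrow> a \<noteq> c \<Longrightarrow> b \<noteq> d \<Longrightarrow> False"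
  using acyclic_E[of "[a, b, c, d]"] edge_neq[of a b] edge_neq[of b c] edge_neq[of c d] edge_neq[of d a]
  by (auto simp: is_cycle_def less_Suc_eq)

lemma no_5_cycle:
  "{a, b} \<in> E \<Longrightarrow> {b, c} \<in> E \<Longrightarrow> {c, d} \<in> E \<Longrightarrow> {d, e} \<in> E \<Longrightarrow> {e, a} \<in> E \<Longrightarrow>
    distinct [a, b, c, d, e] \<Longrightarrow> False"
  using acyclic_E[of "[a, b, c, d, e]"]
  by (auto simp: is_cycle_def less_Suc_eq)

lemma finite_nbrs: "finite (nbrs E x)"
proof (rule finite_subset)
  show "nbrs E x \<subseteq> \<Union>E" by (auto simp: nbrs_def)
  show "finite (\<Union>E)" using finite_E card_E by (intro finite_Union) (auto intro!: card_ge_0_finite)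
qed

text \<open>Passes from sums over neighbours, as in the random walk, to sums over incident edges, as
  in \<open>tree_map\<close>, by matching \<open>y\<close> with the edge
  \<open>{u, y}\<close>.\<close>

lemma wdeg_eq_other_sum:
  assumes "{u, v} \<in> E"
  shows "wdeg E w u = w {u, v} + other_sum E w u {u, v}"
proof -
  have "wdeg E w u = (\<Sum>f\<in>(\<lambda>y. {u, y}) ` nbrs E u. w f)"
    unfolding wdeg_def by (subst sum.reindex) (auto simp: inj_on_def doubleton_eq_iff)
  also have "(\<lambda>y. {u, y}) ` nbrs E u = {f \<in> E. u \<in> f}"
  proof (intro equalityI subsetI)
    fix f assume f: "f \<in> {f \<in> E. u \<in> f}"
    then obtain y where "f = {y, u}" using doubleton_card[OF card_E] by blast
    with f show "f \<in> (\<lambda>y. {u, y}) ` nbrs E u" by (auto simp: nbrs_def insert_commute)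
  qed (auto simp: nbrs_def)
  also have "{f \<in> E. u \<in> f} = insert {u, v} {f \<in> E. u \<in> f \<and> f \<noteq> {u, v}}"
    using assms by auto
  finally show ?thesis using finite_E by (simp add: other_sum_def)
qed

text \<open>The path through \<open>u\<close> and \<open>v\<close> is shortest, since a shortcut
  would close a cycle of length 3, 4 or 5. The excluded pair has distance 1 but potential difference
  -1.\<close>

lemma graph_dist_eq_potential_diff:
  assumes uv: "{u, v} \<in> E" and a: "a \<in> insert u (nbrs E u)" and b: "b \<in> insert v (nbrs E v)"
    and ne: "\<not> (a = v \<and> b = u)"
  shows "real (graph_dist E a b) = potential E u v a - potential E u v b"
proof -
  have vu: "{v, u} \<in> E" using uv by (simp add: insert_commute)
  have "u \<noteq> v" using edge_neq[OF uv] .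
  have dist1: "graph_dist E x y = 1" if "{x, y} \<in> E" for x y
    using that edge_neq[OF that] by (intro graph_dist_eqI) (auto simp: mem_adj_rel)
  have dist2: "graph_dist E x y = 2" if "{x, c} \<in> E" "{c, y} \<in> E" "x \<noteq> y" for x c y
  proof (rule graph_dist_eqI)
    have "{x, y} \<notin> E" using no_triangle[OF that(1,2)] by (auto simp: insert_commute)
    then show "(x, y) \<notin> adj_rel E ^^ m" if "m < 2" for m
      using that \<open>x \<noteq> y\<close> by (auto simp: less_2_cases_iff mem_adj_rel)
  qed (use that in \<open>auto simp: adj_rel_pow_2\<close>)
  have dist3: "graph_dist E y z = 3"
    if y: "{y, u} \<in> E" "y \<noteq> v" and z: "{v, z} \<in> E" "z \<noteq> u" for y z
  proof (rule graph_dist_eqI)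
    show "(y, z) \<in> adj_rel E ^^ 3" using y z uv by (auto simp: adj_rel_pow_3)
    have yv: "{v, y} \<notin> E" using no_triangle[OF y(1) uv] by auto
    have uz: "{z, u} \<notin> E" using no_triangle[OF uv z(1)] by auto
    have yz: "y \<noteq> z" using yv z by auto
    have nyz: "{z, y} \<notin> E" using no_4_cycle[OF y(1) uv z(1)] y z by auto
    have "\<not> ({y, q} \<in> E \<and> {q, z} \<in> E)" for q
    proof
      assume q: "{y, q} \<in> E \<and> {q, z} \<in> E"
      then have "q \<noteq> u" "q \<noteq> v" "q \<noteq> y" "q \<noteq> z"
        using yv uz edge_neq by (auto simp: insert_commute)
      then have "distinct [y, u, v, z, q]"
        using yz \<open>u \<noteq> v\<close> y z edge_neq[OF y(1)] edge_neq[OF z(1)] by auto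
      then show False
        using no_5_cycle[OF y(1) uv z(1), of q] q by (auto simp: insert_commute)
    qed
    then show "(y, z) \<notin> adj_rel E ^^ m" if "m < 3" for m
    proof -
      have "m = 0 \<or> m = 1 \<or> m = 2" using that by auto
      then show ?thesis
        using yz nyz \<open>\<And>q. \<not> ({y, q} \<in> E \<and> {q, z} \<in> E)\<close>
        by (auto simp: adj_rel_pow_2 mem_adj_rel insert_commute)
    qed
  qed
  have a_cases: "a = u \<or> a = v \<or> a \<noteq> u \<and> a \<noteq> v \<and> {a, u} \<in> E \<and> a \<in> nbrs E u"
    using a by (auto simp: nbrs_def insert_commute)
  \<comment> \<open>Without triangles no neighbour of \<open>v\<close> is a neighbour of
    \<open>u\<close>, so neighbours of \<open>v\<close> other than \<open>u\<close> get the last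
    value -2 of the potential.\<close>
  have b_cases: "b = u \<or> b = v \<or> b \<noteq> u \<and> b \<noteq> v \<and> {v, b} \<in> E \<and> b \<notin> nbrs E u"
    using b no_triangle[OF uv, of b] by (auto simp: nbrs_def insert_commute)
  from a_cases b_cases show ?thesis
    using ne \<open>u \<noteq> v\<close> dist1[OF uv] dist1[of a u] dist1[of v b] dist2[OF uv, of b] dist2[OF _ uv, of a]
      dist3[of a b] graph_dist_self[of E]
    by (elim disjE conjE) (simp_all add: potential_def)
qed

text \<open>The bound \<open>1 / 2 \<le> \<alpha>\<close> ensures that no mass has to leave \<open>v\<close>, so that an optimal
  coupling avoids the only move against the potential.\<close>

lemma kappa_eq:
  assumes uv: "{u, v} \<in> E" and pos: "\<forall>e\<in>E. 0 < w e" and \<alpha>: "1 / 2 \<le> \<alpha>" "\<alpha> < 1"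
  shows "kappa E w \<alpha> u v = (1 - \<alpha>) * (2 * w {u, v} / wdeg E w u + 2 * w {u, v} / wdeg E w v - 2)"
proof -
  define \<mu> \<nu> where "\<mu> = lazy_walk E w \<alpha> u" and "\<nu> = lazy_walk E w \<alpha> v"
  define f where "f = potential E u v"
  define W du dv where "W = w {u, v}" and "du = wdeg E w u" and "dv = wdeg E w v"
  have vu: "{v, u} \<in> E" "w {v, u} = W" using uv by (simp_all add: insert_commute W_def)
  have "u \<noteq> v" using edge_neq[OF uv] .
  have nb: "v \<in> nbrs E u" "u \<in> nbrs E v" using uv vu by (auto simp: nbrs_def)
  have W: "0 < W" using pos uv by (simp add: W_def)
  have "0 \<le> other_sum E w x e" for x e by (rule other_sum_nonneg) (use pos in \<open>auto simp: less_imp_le\<close>)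
  then have d: "W \<le> du" "W \<le> dv"
    using wdeg_eq_other_sum[OF uv, of w] wdeg_eq_other_sum[OF vu(1), of w] vu(2)
    by (simp_all add: W_def du_def dv_def)
  have pmf\<mu>: "pmf \<mu> z = (if z = u then \<alpha> else if z \<in> nbrs E u then (1 - \<alpha>) * w {u, z} / du else 0)" for z
    unfolding \<mu>_def du_def using card_E finite_nbrs nb pos \<alpha> by (intro pmf_lazy_walk) auto
  have pmf\<nu>: "pmf \<nu> z = (if z = v then \<alpha> else if z \<in> nbrs E v then (1 - \<alpha>) * w {v, z} / dv else 0)" for z
    unfolding \<nu>_def dv_def using card_E finite_nbrs nb pos \<alpha> by (intro pmf_lazy_walk) auto
  have sup: "set_pmf \<mu> \<subseteq> insert u (nbrs E u)" "set_pmf \<nu> \<subseteq> insert v (nbrs E v)"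
    by (auto simp: set_pmf_iff pmf\<mu> pmf\<nu> split: if_splits)
  have fin: "finite (set_pmf \<mu>)" "finite (set_pmf \<nu>)"
    using sup finite_nbrs by (auto intro: finite_subset)
  have "W / du \<le> 1" using d W by simp
  then have "(1 - \<alpha>) * (W / du) \<le> (1 - \<alpha>) * 1" using \<alpha> by (intro mult_left_mono) auto
  then have lev: "pmf \<mu> v \<le> pmf \<nu> v"
    using nb \<open>u \<noteq> v\<close> \<alpha> by (simp add: pmf\<mu> pmf\<nu> W_def)
  have W1: "wasserstein1 (\<lambda>a b. real (graph_dist E a b)) \<mu> \<nu>
      = measure_pmf.expectation \<mu> f - measure_pmf.expectation \<nu> f"
  proof (rule wasserstein1_eq_potential_diff[OF fin])
    fix a b assume ab: "a \<in> set_pmf \<mu>" "b \<in> set_pmf \<nu>"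
    show "f a - f b \<le> real (graph_dist E a b)"
    proof (cases "a = v \<and> b = u")
      \<comment> \<open>Only the one-sided Lipschitz bound is required, and at the exceptional pair
        the difference -1 satisfies it trivially.\<close>
      case True
      then show ?thesis using \<open>u \<noteq> v\<close> by (simp add: f_def potential_def)
    next
      case False
      with ab sup show ?thesis
        unfolding f_def by (subst graph_dist_eq_potential_diff[OF uv]) auto
    qed
  next
    fix a b assume ab: "pmf \<nu> a < pmf \<mu> a" "pmf \<mu> b < pmf \<nu> b"
    then have "a \<noteq> v" using lev by auto
    have "0 < pmf \<mu> a" "0 < pmf \<nu> b" using ab by (metis pmf_nonneg order.strict_trans1)+
    then have "a \<in> set_pmf \<mu>" "b \<in> set_pmf \<nu>" by (auto simp: set_pmf_iff)
    with sup \<open>a \<noteq> v\<close> show "real (graph_dist E a b) = f a - f b"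
      unfolding f_def by (intro graph_dist_eq_potential_diff[OF uv]) auto
  qed (simp add: graph_dist_self)
  have fu: "f u = 0" and fv: "f v = - 1" using \<open>u \<noteq> v\<close> by (simp_all add: f_def potential_def)
  \<comment> \<open>The potential is constant on each of these sets, 1 on \<open>Nu\<close> and -2
    on \<open>Nv\<close>, so each contributes to its expectation only through its total
    mass.\<close>
  define Nu Nv where "Nu = nbrs E u - {v}" and "Nv = nbrs E v - {u}"
  have ns: "{x} \<notin> E" for x using edge_neq[of x x] by auto
  have Nu: "finite Nu" "u \<notin> Nu" "v \<notin> Nu" "nbrs E u = insert v Nu"
    using finite_nbrs nb ns by (auto simp: Nu_def nbrs_def)
  have Nv: "finite Nv" "u \<notin> Nv" "v \<notin> Nv" "nbrs E v = insert u Nv"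
    using finite_nbrs nb ns by (auto simp: Nv_def nbrs_def)
  have sNu: "(\<Sum>y\<in>Nu. w {u, y}) = du - W" and sNv: "(\<Sum>y\<in>Nv. w {v, y}) = dv - W"
    using Nu Nv vu by (simp_all add: du_def dv_def wdeg_def W_def)
  have "measure_pmf.expectation \<mu> f = (\<Sum>a\<in>insert u (insert v Nu). f a * pmf \<mu> a)"
    using sup Nu by (intro integral_measure_pmf_real) auto
  also have "\<dots> = f u * pmf \<mu> u + f v * pmf \<mu> v + (\<Sum>a\<in>Nu. f a * pmf \<mu> a)"
    using Nu \<open>u \<noteq> v\<close> by simp
  also have "(\<Sum>a\<in>Nu. f a * pmf \<mu> a) = (\<Sum>a\<in>Nu. (1 - \<alpha>) / du * w {u, a})"
    using Nu by (intro sum.cong) (auto simp: f_def potential_def pmf\<mu>)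
  also have "\<dots> = (1 - \<alpha>) / du * (du - W)" unfolding sum_distrib_left[symmetric] sNu ..
  finally have E\<mu>: "measure_pmf.expectation \<mu> f = (1 - \<alpha>) * (1 - 2 * W / du)"
    using \<open>u \<noteq> v\<close> nb d W by (simp add: fu fv pmf\<mu> W_def[symmetric] divide_simps) (simp add: algebra_simps)
  have fNv: "f a = - 2" if "a \<in> Nv" for a
    using that Nv no_triangle[OF uv, of a] by (auto simp: f_def potential_def nbrs_def insert_commute)
  have "measure_pmf.expectation \<nu> f = (\<Sum>a\<in>insert v (insert u Nv). f a * pmf \<nu> a)"
    using sup Nv by (intro integral_measure_pmf_real) auto
  also have "\<dots> = f v * pmf \<nu> v + f u * pmf \<nu> u + (\<Sum>a\<in>Nv. f a * pmf \<nu> a)"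
    using Nv \<open>u \<noteq> v\<close> by simp
  also have "(\<Sum>a\<in>Nv. f a * pmf \<nu> a) = (\<Sum>a\<in>Nv. - 2 * ((1 - \<alpha>) / dv * w {v, a}))"
    using Nv by (intro sum.cong) (auto simp: fNv pmf\<nu>)
  also have "\<dots> = - 2 * ((1 - \<alpha>) / dv * (dv - W))" unfolding sum_distrib_left[symmetric] sNv ..
  finally have E\<nu>: "measure_pmf.expectation \<nu> f = - \<alpha> - 2 * (1 - \<alpha>) * (1 - W / dv)"
    using \<open>u \<noteq> v\<close> d W by (simp add: fu fv pmf\<nu> divide_simps)
  have "kappa E w \<alpha> u v = 1 - ((1 - \<alpha>) * (1 - 2 * W / du) - (- \<alpha> - 2 * (1 - \<alpha>) * (1 - W / dv)))"
    unfolding kappa_def \<mu>_def[symmetric] \<nu>_def[symmetric] W1 E\<mu> E\<nu> ..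
  also have "\<dots> = (1 - \<alpha>) * (2 * (W / du) + 2 * (W / dv) - 2)"
    unfolding times_divide_eq_right[symmetric] by algebra
  finally show ?thesis by (simp add: W_def du_def dv_def)
qed

text \<open>By \<open>kappa_eq\<close> the quotient does not depend on \<open>\<alpha>\<close> in a
  left neighbourhood of 1, so the limit is its constant value.\<close>

lemma kappa_LLY_eq:
  assumes "{u, v} \<in> E" and "\<forall>e\<in>E. 0 < w e"
  shows "kappa_LLY E w u v = 2 * w {u, v} / wdeg E w u + 2 * w {u, v} / wdeg E w v - 2"
  unfolding kappa_LLY_def
proof (rule tendsto_Lim)
  have "eventually (\<lambda>\<alpha>. \<alpha> \<in> {1 / 2<..<1}) (at_left (1 :: real))"
    by (rule eventually_at_leftI[of "1 / 2"]) auto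
  then have "eventually (\<lambda>\<alpha>. kappa E w \<alpha> u v / (1 - \<alpha>) =
      2 * w {u, v} / wdeg E w u + 2 * w {u, v} / wdeg E w v - 2) (at_left 1)"
    by eventually_elim (subst kappa_eq[OF assms], auto)
  then show "((\<lambda>\<alpha>. kappa E w \<alpha> u v / (1 - \<alpha>)) \<longlongrightarrow>
      2 * w {u, v} / wdeg E w u + 2 * w {u, v} / wdeg E w v - 2) (at_left 1)"
    by (rule tendsto_eventually)
qed simp

text \<open>With degrees \<open>W + A\<close> and \<open>W + B\<close>, the numerator over the
  common denominator collapses to \<open>2 * (W\<^sup>2 - A * B)\<close>. The positive denominator
  then lets the sign of the curvature be read off.\<close>

lemma kappa_LLY_eq_other_sum:
  assumes uv: "{u, v} \<in> E" and pos: "\<forall>e\<in>E. 0 < w e"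
  shows "kappa_LLY E w u v = 2 * ((w {u, v})\<^sup>2 - other_sum E w u {u, v} * other_sum E w v {u, v}) /
    (wdeg E w u * wdeg E w v)"
    and "0 < wdeg E w u * wdeg E w v"
proof -
  have vu: "{v, u} \<in> E" "w {v, u} = w {u, v}" using uv by (simp_all add: insert_commute)
  define W A B where "W = w {u, v}" and "A = other_sum E w u {u, v}" and "B = other_sum E w v {u, v}"
  have "0 < W" "0 \<le> A" "0 \<le> B"
    using pos uv by (auto simp: W_def A_def B_def less_imp_le intro!: other_sum_nonneg)
  moreover have wd: "wdeg E w u = W + A" "wdeg E w v = W + B"
    using wdeg_eq_other_sum[OF uv, of w] wdeg_eq_other_sum[OF vu(1), of w] vu(2)
    by (simp_all add: W_def A_def B_def insert_commute)
  ultimately show "kappa_LLY E w u v = 2 * ((w {u, v})\<^sup>2 - other_sum E w u {u, v} * other_sum E w v {u, v}) /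
      (wdeg E w u * wdeg E w v)"
    unfolding kappa_LLY_eq[OF assms] wd W_def[symmetric] A_def[symmetric] B_def[symmetric]
    by (simp add: divide_simps) (simp add: algebra_simps power2_eq_square)
  show "0 < wdeg E w u * wdeg E w v"
    unfolding wd using \<open>0 < W\<close> \<open>0 \<le> A\<close> \<open>0 \<le> B\<close> by simp
qed

lemma admissible_iff:
  "admissible E w \<longleftrightarrow> w \<in> pos_weights E \<and>
    (\<forall>u v. {u, v} \<in> E \<longrightarrow> other_sum E w u {u, v} * other_sum E w v {u, v} \<le> (w {u, v})\<^sup>2)"
proof -
  have "0 \<le> kappa_LLY E w u v \<longleftrightarrow> other_sum E w u {u, v} * other_sum E w v {u, v} \<le> (w {u, v})\<^sup>2"
    if "w \<in> pos_weights E" "{u, v} \<in> E" for u v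
  proof -
    have "\<forall>e\<in>E. 0 < w e"
      using \<open>w \<in> pos_weights E\<close> by (auto simp: pos_weights_def PiE_iff)
    from kappa_LLY_eq_other_sum[OF that(2) this] show ?thesis
      by (simp add: zero_le_divide_iff)
  qed
  then show ?thesis by (auto simp: admissible_def)
qed

end

section \<open>Optimal weights\<close>

context finite_forest
begin

section \<open>The fixed point as an admissible weight\<close>

lemma pos_weightsD: "w \<in> pos_weights E \<Longrightarrow> e \<in> E \<Longrightarrow> 0 < w e"
  by (auto simp: pos_weights_def PiE_iff)

lemma w_star_ge_1: "e \<in> E \<Longrightarrow> 1 \<le> w_star E e"
  using w_star_in by (auto simp: PiE_iff)

lemma w_star_pos: "e \<in> E \<Longrightarrow> 0 < w_star E e"
  using w_star_ge_1[of e] by simp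

lemma w_star_in_pos_weights: "w_star E \<in> pos_weights E"
  using w_star_in w_star_pos by (auto simp: pos_weights_def PiE_iff)

lemma admissible_w_star: "admissible E (w_star E)"
  unfolding admissible_iff
proof (intro conjI allI impI w_star_in_pos_weights)
  fix u v assume "{u, v} \<in> E"
  then show "other_sum E (w_star E) u {u, v} * other_sum E (w_star E) v {u, v} \<le> (w_star E {u, v})\<^sup>2"
    using tree_map_le_iff[of u v "w_star E"] w_star_ge_1 w_star_pos tree_map_w_star
    by (simp add: less_imp_le)
qed

lemma leaf_edge_unique:
  assumes "card (nbrs E v) = 1" "e \<in> E" "v \<in> e" "f \<in> E" "v \<in> f"
  shows "f = e"
proof -
  obtain y where y: "nbrs E v = {y}" using assms(1) by (rule card_1_singletonE)
  have "g = {v, y}" if g: "g \<in> E" "v \<in> g" for g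
  proof -
    obtain x where x: "g = {x, v}" using doubleton_card[OF card_E] g by blast
    then have "x \<in> nbrs E v" using g by (simp add: nbrs_def insert_commute)
    then show ?thesis using x y by auto
  qed
  then show ?thesis using assms by blast
qed

text \<open>The sum at the leaf is empty, so the product vanishes and the maximum is 1.\<close>

lemma w_star_pendant:
  assumes e: "e \<in> E" "pendant E e"
  shows "w_star E e = 1"
proof -
  obtain v where v: "v \<in> e" "card (nbrs E v) = 1" using e by (auto simp: pendant_def)
  have "other_sum E (w_star E) v e = 0"
    unfolding other_sum_def using leaf_edge_unique[OF v(2) e(1) v(1)] by (intro sum.neutral) auto
  moreover have "finite e" using card_E[OF e(1)] by (auto intro: card_ge_0_finite)
  ultimately have "(\<Prod>u\<in>e. other_sum E (w_star E) u e) = 0" using v(1) by (auto intro: prod_zero)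
  then have "tree_map E (w_star E) e = 1" using e(1) by (simp add: tree_map_def)
  then show ?thesis by (simp add: tree_map_w_star)
qed

lemma other_sum_w_star_ge_1:
  assumes uv: "{u, v} \<in> E" and "card (nbrs E u) \<noteq> 1"
  shows "1 \<le> other_sum E (w_star E) u {u, v}"
proof -
  have "nbrs E u \<noteq> {v}" using assms(2) by auto
  then obtain y where y: "{u, y} \<in> E" "y \<noteq> v" using uv by (auto simp: nbrs_def)
  then have "{u, y} \<in> {f \<in> E. u \<in> f \<and> f \<noteq> {u, v}}" by (auto simp: doubleton_eq_iff)
  then have "w_star E {u, y} \<le> other_sum E (w_star E) u {u, v}"
    unfolding other_sum_def using finite_E w_star_pos by (intro member_le_sum) (auto simp: less_imp_le)
  then show ?thesis using w_star_ge_1[OF y(1)] by simp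
qed

text \<open>Neither end is a leaf, so each sum contains a weight that is at least 1. The square root
  is then at least 1 and determines the maximum.\<close>

lemma w_star_non_pendant:
  assumes uv: "{u, v} \<in> E" and np: "\<not> pendant E {u, v}"
  shows "1 \<le> other_sum E (w_star E) u {u, v}" "1 \<le> other_sum E (w_star E) v {u, v}"
    and "(w_star E {u, v})\<^sup>2 = other_sum E (w_star E) u {u, v} * other_sum E (w_star E) v {u, v}"
proof -
  show ge: "1 \<le> other_sum E (w_star E) u {u, v}" "1 \<le> other_sum E (w_star E) v {u, v}"
    using other_sum_w_star_ge_1[of u v] other_sum_w_star_ge_1[of v u] uv np
    by (auto simp: pendant_def insert_commute)
  have "1 \<le> other_sum E (w_star E) u {u, v} * other_sum E (w_star E) v {u, v}"
    using mult_mono[OF ge] ge by simp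
  then show "(w_star E {u, v})\<^sup>2 = other_sum E (w_star E) u {u, v} * other_sum E (w_star E) v {u, v}"
    using tree_map_edge[OF uv edge_neq[OF uv], of "w_star E"] by (simp add: tree_map_w_star max_def)
qed

lemma kappa_LLY_w_star_non_pendant:
  assumes "{u, v} \<in> E" "\<not> pendant E {u, v}"
  shows "kappa_LLY E (w_star E) u v = 0"
  using kappa_LLY_eq_other_sum(1)[OF assms(1), of "w_star E"] w_star_pos w_star_non_pendant(3)[OF assms]
  by simp

text \<open>An admissible weight with values at least 1 is a supersolution, so the comparison
  principle applies to the fixed point.\<close>

lemma w_star_le_admissible:
  assumes z: "admissible E z" "\<forall>e\<in>E. 1 \<le> z e" and e: "e \<in> E"
  shows "w_star E e \<le> z e"
proof (rule subsolution_le_supersolution[OF _ _ _ _ e])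
  fix f assume f: "f \<in> E"
  obtain u v where uv: "f = {u, v}" using edgeE[OF f] by metis
  have "0 \<le> z g" if "g \<in> E" for g using z(2) that by force
  then show "tree_map E z f \<le> z f"
    using tree_map_le_iff[of u v z] z f uv by (simp add: admissible_iff)
qed (use z w_star_pos tree_map_w_star in \<open>simp_all add: less_imp_le\<close>)

text \<open>At a non-pendant edge \<open>w_star\<close> solves the equation with positive sums on both ends, so
  equality with a larger admissible weight spreads to the adjacent edges.\<close>

lemma admissible_eq_w_star_spreads:
  assumes z: "admissible E z" "\<forall>e\<in>E. 1 \<le> z e"
    and uv: "{u, v} \<in> E" "\<not> pendant E {u, v}" and eq: "w_star E {u, v} = z {u, v}"
    and f: "f \<in> E" "u \<in> f"
  shows "w_star E f = z f"
proof (cases "f = {u, v}")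
  case False
  note le = w_star_le_admissible[OF z]
  define A B A' B' where "A = other_sum E (w_star E) u {u, v}" and "B = other_sum E (w_star E) v {u, v}"
    and "A' = other_sum E z u {u, v}" and "B' = other_sum E z v {u, v}"
  have "A \<le> A'" "B \<le> B'"
    unfolding A_def B_def A'_def B'_def using le by (auto intro: other_sum_mono)
  moreover have "1 \<le> A" "1 \<le> B" "A * B = (z {u, v})\<^sup>2"
    using w_star_non_pendant[OF uv] eq by (simp_all add: A_def B_def)
  moreover from this(3) have "A' * B' \<le> A * B"
    using z(1) uv(1) by (simp add: admissible_iff A'_def B'_def)
  \<comment> \<open>A strict gain in one sum would make the product for \<open>z\<close> exceed
    \<open>A * B\<close>, against admissibility of \<open>z\<close>. Hence the sums at
    \<open>u\<close> agree, and so do their termwise ordered summands.\<close>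
  moreover have "A * B < A' * B'" if "A < A'"
  proof -
    have "A * B < A' * B" using that \<open>1 \<le> B\<close> by simp
    also have "\<dots> \<le> A' * B'" using \<open>B \<le> B'\<close> \<open>1 \<le> A\<close> \<open>A \<le> A'\<close> by (intro mult_left_mono) auto
    finally show ?thesis .
  qed
  ultimately have "A = A'" by fastforce
  then show ?thesis
    using other_sum_eq_imp[OF finite_E, of "w_star E" z u "{u, v}" f] le f False
    unfolding A_def A'_def by blast
qed (use eq in simp)

end

section \<open>Distortion, normalization and optimality of the fixed point\<close>

locale nonempty_finite_forest = finite_forest +
  assumes E_ne: "E \<noteq> {}"
begin

text \<open>Supplies an edge on which \<open>w_star\<close> equals 1, so that its minimum is 1 and
  it is normalized.\<close>

lemma pendant_edge_exists: "\<exists>e\<in>E. pendant E e"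
proof -
  obtain v e where v: "e \<in> E" "v \<in> e" "\<forall>f\<in>E. v \<in> f \<longrightarrow> f = e"
    using leaf_exists[OF finite_E card_E acyclic_E E_ne] by blast
  obtain u where u: "e = {u, v}" using doubleton_card[OF card_E] v by blast
  have "nbrs E v = {u}"
  proof (intro equalityI subsetI)
    fix y assume "y \<in> nbrs E v"
    then have y: "{v, y} \<in> E" by (simp add: nbrs_def)
    have "{v, y} = {u, v}" using bspec[OF v(3) y] by (simp add: u)
    then show "y \<in> {u}" using edge_neq[OF y] by (auto simp: doubleton_eq_iff)
  qed (use u v(1) in \<open>simp add: nbrs_def insert_commute\<close>)
  then have "card (nbrs E v) = 1" by simp
  then have "pendant E e" using v(2) unfolding pendant_def by blast
  then show ?thesis using v(1) by blast
qed

lemma distortion_eq: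
  assumes z: "z \<in> pos_weights E"
  shows "distortion E z = ereal (Max (z ` E) / Min (z ` E))" and "0 < Min (z ` E)"
proof -
  have fin: "finite (z ` E)" "z ` E \<noteq> {}" using finite_E E_ne by auto
  show m: "0 < Min (z ` E)" using fin pos_weightsD[OF z] by simp
  obtain a b where a: "a \<in> E" "Max (z ` E) = z a" and b: "b \<in> E" "Min (z ` E) = z b"
    using Max_in[OF fin] Min_in[OF fin] by auto
  have "z e \<le> z a" "z b \<le> z e" if "e \<in> E" for e
    using Max_ge[OF fin(1), of "z e"] Min_le[OF fin(1), of "z e"] a(2) b(2) that by simp_all
  note ab = this
  have "(SUP e\<in>E. ereal (z e)) = ereal (Max (z ` E))"
    unfolding a(2) using a(1) ab(1) by (intro SUP_eqI) auto
  moreover have "(INF e\<in>E. ereal (z e)) = ereal (Min (z ` E))"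
    unfolding b(2) using b(1) ab(2) by (intro INF_eqI) auto
  ultimately show "distortion E z = ereal (Max (z ` E) / Min (z ` E))"
    using m by (simp add: distortion_def Let_def)
qed

lemma normalized_iff:
  assumes "z \<in> pos_weights E"
  shows "normalized E z \<longleftrightarrow> Min (z ` E) = 1"
  using distortion_eq(1)[OF assms] cInf_eq_Min[of "z ` E"] finite_E E_ne
  by (simp add: normalized_def)

lemma normalized_ge_1:
  assumes "z \<in> pos_weights E" "normalized E z"
  shows "\<forall>e\<in>E. 1 \<le> z e"
proof
  fix e assume "e \<in> E"
  then show "1 \<le> z e"
    using assms finite_E Min_le[of "z ` E" "z e"] by (simp add: normalized_iff)
qed

lemma normalized_w_star: "normalized E (w_star E)"
proof -
  obtain e where "e \<in> E" "w_star E e = 1" using pendant_edge_exists w_star_pendant by blast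
  then have "Min (w_star E ` E) = 1"
    using finite_E w_star_ge_1 by (intro Min_eqI) (auto simp: image_iff intro: bexI[of _ e])
  then show ?thesis by (simp add: normalized_iff[OF w_star_in_pos_weights])
qed

lemma distortion_w_star: "distortion E (w_star E) = ereal (Max (w_star E ` E))"
  using distortion_eq(1)[OF w_star_in_pos_weights] normalized_w_star
  by (simp add: normalized_iff[OF w_star_in_pos_weights])

text \<open>Restricted to \<open>E\<close> to stay extensional, so that it can be compared with
  \<open>w_star\<close> by equality of functions.\<close>

definition normalize_weight :: "('a set \<Rightarrow> real) \<Rightarrow> 'a set \<Rightarrow> real" where
  "normalize_weight z = (\<lambda>e\<in>E. 1 / Min (z ` E) * z e)"

text \<open>The admissibility inequality is homogeneous and distortion is invariant under scaling,
  so questions of optimality reduce to weights of minimum 1.\<close>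

lemma
  assumes z: "admissible E z"
  shows admissible_normalize_weight: "admissible E (normalize_weight z)"
    and normalized_normalize_weight: "normalized E (normalize_weight z)"
    and distortion_normalize_weight: "distortion E (normalize_weight z) = distortion E z"
proof -
  define m where "m = Min (z ` E)"
  have zp: "z \<in> pos_weights E" using z by (simp add: admissible_def)
  have m: "0 < m" using distortion_eq(2)[OF zp] by (simp add: m_def)
  have np: "normalize_weight z \<in> pos_weights E"
    using pos_weightsD[OF zp] m by (auto simp: pos_weights_def normalize_weight_def m_def)
  have eq: "normalize_weight z e = 1 / m * z e" if "e \<in> E" for e
    using that by (simp add: normalize_weight_def m_def)
  show "admissible E (normalize_weight z)"
    unfolding admissible_iff
  proof (intro conjI allI impI np)
    fix u v assume uv: "{u, v} \<in> E"
    then have "(1 / m)\<^sup>2 * (other_sum E z u {u, v} * other_sum E z v {u, v}) \<le> (1 / m)\<^sup>2 * (z {u, v})\<^sup>2"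
      using z by (intro mult_left_mono) (auto simp: admissible_iff)
    then show "other_sum E (normalize_weight z) u {u, v} * other_sum E (normalize_weight z) v {u, v}
        \<le> (normalize_weight z {u, v})\<^sup>2"
      using other_sum_cmult[of E "normalize_weight z" "1 / m" z, OF eq] uv
      by (simp add: eq power2_eq_square)
  qed
  have im: "normalize_weight z ` E = (\<lambda>x. 1 / m * x) ` z ` E"
    unfolding image_image using eq by (rule image_cong[OF refl])
  have mono: "mono (\<lambda>x. 1 / m * x)" using m by (intro monoI mult_left_mono) auto
  have fin: "finite (z ` E)" "z ` E \<noteq> {}" using finite_E E_ne by auto
  have Min: "Min (normalize_weight z ` E) = 1"
    unfolding im mono_Min_commute[OF mono fin, symmetric] using m by (simp add: m_def)
  have Max: "Max (normalize_weight z ` E) = 1 / m * Max (z ` E)"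
    unfolding im mono_Max_commute[OF mono fin, symmetric] ..
  show "normalized E (normalize_weight z)" using Min by (simp add: normalized_iff[OF np])
  show "distortion E (normalize_weight z) = distortion E z"
    unfolding distortion_eq(1)[OF np] distortion_eq(1)[OF zp] Min Max by (simp add: m_def)
qed

text \<open>After normalization both minima are 1, so the distortions are the maxima, and these are
  ordered by coordinatewise minimality.\<close>

lemma distortion_w_star_le:
  assumes "admissible E z"
  shows "distortion E (w_star E) \<le> distortion E z"
proof -
  define y where "y = normalize_weight z"
  have y: "admissible E y" "normalized E y" and d: "distortion E z = distortion E y"
    using assms admissible_normalize_weight normalized_normalize_weight distortion_normalize_weight
    by (simp_all add: y_def)
  have yp: "y \<in> pos_weights E" using y by (simp add: admissible_def)
  have "w_star E e \<le> Max (y ` E)" if "e \<in> E" for e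
    using w_star_le_admissible[OF y(1) normalized_ge_1[OF yp y(2)] that] that finite_E
    by (intro order_trans[OF _ Max_ge[of "y ` E" "y e"]]) auto
  then have "Max (w_star E ` E) \<le> Max (y ` E)" using finite_E E_ne by simp
  then show ?thesis
    unfolding d distortion_w_star distortion_eq(1)[OF yp]
    using y(2) by (simp add: normalized_iff[OF yp])
qed

lemma DN_LLY_eq_distortion_w_star: "DN_LLY E = distortion E (w_star E)"
  unfolding DN_LLY_def
  using admissible_w_star distortion_w_star_le by (intro INF_eqI) auto

lemma optimal_w_star: "optimal E (w_star E)"
  using admissible_w_star by (simp add: optimal_def DN_LLY_eq_distortion_w_star)

end

section \<open>Uniqueness of the optimal weight on a tree\<close>

locale nonempty_finite_tree = finite_tree +
  assumes E_nonempty: "E \<noteq> {}"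

sublocale nonempty_finite_tree \<subseteq> nonempty_finite_forest E
proof
  show "finite E" using finite_V edge_subset by (meson Pow_iff finite_Pow_iff finite_subset subsetI)
qed (use edge_card acyclic E_nonempty in auto)

context nonempty_finite_tree
begin

text \<open>Equal distortion and minimum 1 force equal maxima. On an edge \<open>e\<close> where
  \<open>w_star\<close> is maximal, \<open>z\<close> is squeezed between \<open>w_star\<close> and
  that maximum; connectedness carries the equality from there to every edge.\<close>

lemma normalized_optimal_eq_w_star:
  assumes z: "normalized E z" "optimal E z"
  shows "z = w_star E"
proof -
  have za: "admissible E z" and zp: "z \<in> pos_weights E"
    using z by (auto simp: optimal_def admissible_def)
  note z1 = normalized_ge_1[OF zp z(1)]
  note le = w_star_le_admissible[OF za z1]
  have fin: "finite (z ` E)" "finite (w_star E ` E)" "w_star E ` E \<noteq> {}"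
    using finite_E E_ne by auto
  have Max_eq: "Max (z ` E) = Max (w_star E ` E)"
    using z distortion_eq(1)[OF zp] DN_LLY_eq_distortion_w_star distortion_w_star
    by (simp add: optimal_def normalized_iff[OF zp])
  obtain e where e: "e \<in> E" "w_star E e = Max (w_star E ` E)"
    using Max_in[OF fin(2,3)] by auto
  have z_le: "z f \<le> w_star E e" if "f \<in> E" for f
    using Max_ge[OF fin(1)] that e Max_eq by simp
  have "w_star E f = z f" if f: "f \<in> E" for f
  proof (cases "pendant E e")
    case True
    \<comment> \<open>If the maximal edge is pendant, the common maximum is 1, so both weights are
      constantly 1.\<close>
    then show ?thesis using w_star_pendant[OF e(1)] z_le[OF f] le[OF f] w_star_ge_1[OF f] by simp
  next
    case False
    define P where "P x \<longleftrightarrow> (\<forall>f\<in>E. x \<in> f \<longrightarrow> w_star E f = z f)" for x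
    \<comment> \<open>\<open>P\<close> does not pass from a leaf to its neighbour, since \<open>w_star\<close> is only pinned at non-pendant edges.\<close>
    define Q where "Q x \<longleftrightarrow> P x \<and> (card (nbrs E x) = 1 \<longrightarrow> (\<forall>y\<in>nbrs E x. P y))" for x
    obtain u v where uv: "e = {u, v}" using edgeE[OF e(1)] by metis
    have "w_star E e = z e" using z_le[OF e(1)] le[OF e(1)] by simp
    then have "P u"
      unfolding P_def using admissible_eq_w_star_spreads[OF za z1, of u v] e(1) uv False by blast
    \<comment> \<open>The end \<open>u\<close> of a non-pendant edge is not a leaf, so the second
      clause of \<open>Q u\<close> holds vacuously.\<close>
    moreover have "card (nbrs E u) \<noteq> 1" using False uv by (auto simp: pendant_def)
    ultimately have Qu: "Q u" by (simp add: Q_def)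
    have step: "Q y" if "Q x" and xy: "{x, y} \<in> E" for x y
    proof -
      have leaf: "y' = x" if "card (nbrs E y) = 1" "y' \<in> nbrs E y" for y'
      proof -
        have "x \<in> nbrs E y" using xy by (simp add: nbrs_def insert_commute)
        then show ?thesis using that by (metis card_1_singletonE singletonD)
      qed
      have "P y"
      \<comment> \<open>If \<open>x\<close> is a leaf, \<open>Q x\<close> already contains
        \<open>P y\<close>. If \<open>y\<close> is a leaf, its only edge is covered by
        \<open>P x\<close>. Otherwise the edge is non-pendant and equality spreads across
        it.\<close>
      proof (cases "card (nbrs E x) = 1 \<or> card (nbrs E y) = 1")
        case True
        then show ?thesis
        proof
          assume "card (nbrs E x) = 1"
          then show "P y" using \<open>Q x\<close> xy by (simp add: Q_def nbrs_def)
        next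
          assume "card (nbrs E y) = 1"
          then have "g = {x, y}" if "g \<in> E" "y \<in> g" for g
            using leaf_edge_unique[of y "{x, y}" g] xy that by simp
          then show "P y" using \<open>Q x\<close> xy by (auto simp: Q_def P_def)
        qed
      next
        case False
        then have "\<not> pendant E {y, x}" by (simp add: pendant_def)
        moreover have "{y, x} \<in> E" "w_star E {y, x} = z {y, x}"
          using \<open>Q x\<close> xy by (auto simp: Q_def P_def insert_commute)
        ultimately show ?thesis
          unfolding P_def using admissible_eq_w_star_spreads[OF za z1, of y x] by blast
      qed
      \<comment> \<open>For a leaf \<open>y\<close> the second clause of \<open>Q y\<close> concerns
        only its single neighbour \<open>x\<close>, where \<open>P\<close> is known.\<close>
      then show ?thesis using leaf \<open>Q x\<close> by (auto simp: Q_def)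
    qed
    obtain a b where ab: "f = {a, b}" using edgeE[OF f] by metis
    have "(u, a) \<in> (adj_rel E)\<^sup>*"
      using connected edge_subset[OF f] edge_subset[OF e(1)] ab uv by simp
    then have "Q a"
      by (induction rule: rtrancl_induct) (use Qu step in \<open>auto simp: adj_rel_def\<close>)
    then show ?thesis using f ab by (auto simp: Q_def P_def)
  qed
  then show ?thesis
    using zp w_star_in_pos_weights unfolding pos_weights_def by (intro PiE_ext[of z E _ "w_star E"]) auto
qed

lemma optimal_eq_cmult_w_star:
  assumes z: "optimal E z"
  shows "\<exists>c>0. \<forall>e\<in>E. z e = c * w_star E e"
proof -
  have za: "admissible E z" and d: "distortion E z = DN_LLY E" using z by (auto simp: optimal_def)
  have m: "0 < Min (z ` E)" using za distortion_eq(2) by (simp add: admissible_def)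
  have "optimal E (normalize_weight z)"
    using admissible_normalize_weight[OF za] distortion_normalize_weight[OF za] d
    by (simp add: optimal_def)
  then have eq: "normalize_weight z = w_star E"
    by (intro normalized_optimal_eq_w_star normalized_normalize_weight[OF za])
  have "z e = Min (z ` E) * w_star E e" if "e \<in> E" for e
    unfolding eq[symmetric] using that m by (simp add: normalize_weight_def)
  then show ?thesis using m by blast
qed

end

theorem theorem1p3:
  fixes V :: "'a set" and E :: "'a set set"
  assumes "finite_tree V E" and "E \<noteq> {}"
  shows "(\<exists>!w. w \<in> E \<rightarrow>\<^sub>E {1..} \<and> tree_map E w = w)
    \<and> DN_LLY E = ereal (Max (w_star E ` E))
    \<and> (normalized E (w_star E) \<and> admissible E (w_star E)
       \<and> (\<forall>z. normalized E z \<and> admissible E z \<longrightarrow> (\<forall>e\<in>E. w_star E e \<le> z e))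
       \<and> optimal E (w_star E)
       \<and> (\<forall>z. normalized E z \<and> optimal E z \<longrightarrow> z = w_star E)
       \<and> (\<forall>w z. optimal E w \<and> optimal E z \<longrightarrow> (\<exists>c>0. \<forall>e\<in>E. z e = c * w e)))
    \<and> (\<forall>e\<in>E. pendant E e \<longrightarrow> w_star E e = 1)
    \<and> (\<forall>x y. {x, y} \<in> E \<and> \<not> pendant E {x, y} \<longrightarrow> kappa_LLY E (w_star E) x y = 0)"
proof -
  interpret nonempty_finite_tree V E
    using assms by (intro nonempty_finite_tree.intro nonempty_finite_tree_axioms.intro)
  have minimal: "w_star E e \<le> z e" if "normalized E z" "admissible E z" "e \<in> E" for z e
    using w_star_le_admissible[OF that(2) normalized_ge_1[OF _ that(1)]] that by (simp add: admissible_def)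
  have scalar: "\<exists>c>0. \<forall>e\<in>E. z e = c * w e" if w: "optimal E w" and z: "optimal E z" for w z
  proof -
    obtain a b where "0 < a" "\<forall>e\<in>E. w e = a * w_star E e" "0 < b" "\<forall>e\<in>E. z e = b * w_star E e"
      using optimal_eq_cmult_w_star[OF w] optimal_eq_cmult_w_star[OF z] by blast
    then show ?thesis by (intro exI[of _ "b / a"]) auto
  qed
  show ?thesis
    using fixed_point_ex1 DN_LLY_eq_distortion_w_star distortion_w_star normalized_w_star
      admissible_w_star optimal_w_star
    by (intro conjI allI impI ballI)
      (auto intro: minimal scalar normalized_optimal_eq_w_star w_star_pendant
        kappa_LLY_w_star_non_pendant)
qed

end
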